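(* Let $\Omega\subseteq\mathbb{R}$ be an $\omega$-monoid with minimal generating set $\mathcal{G}(\Omega)$. \begin{enumerate} \item If $\mathcal{G}(\Omega)$ is infinite, then $\Omega$ is a tempered monoid. \item If $\mathcal{G}(\Omega)$ is finite, then $\Omega$ is a tempered monoid if and only if $\mathcal{G}(\Omega)$ is not commensurable. \end{enumerate}
   Context: Here $\mathbb{N}=\{1,2,\dots\}$ and $\mathbb{N}_0=\mathbb{N}\cup\{0\}$. An $\omega$-monoid is a submonoid of $(\mathbb{R},+)$ that is increasingly enumerable, i.e., of order type $\omega$. Explicitly, it is a set $\Omega=\{a_0,a_1,a_2,\dots\}\subseteq\mathbb{R}$, where $(a_i)_{i\in\mathbb{N}_0}$ is an infinite sequence with $a_i<a_{i+1}$ for all $i\geq 0$, such that (i) $a_0=0$ and (ii) $a_i+a_j\in\Omega$ for all positive integers $i,j$. A tempered monoid is the set $T$ of elements of an infinite strictly increasing sequence $\tau_0<\tau_1<\tau_2<\cdots$ of nonnegative real numbers such that (i) $\tau_0=0$, (ii) $\tau_i+\tau_j\in T$ for all positive integers $i,j$, and (iii) $\lim_{n\to\infty}(\tau_{n+1}-\tau_n)=0$. For an $\omega$-monoid $\Omega$, let $\Omega^*=\Omega\setminus\{0\}$ be the set of its nonzero elements and $\Omega^*+\Omega^*=\{x+y: x,y\in\Omega^*\}$. The minimal generating set of $\Omega$ is $\mathcal{G}(\Omega)=\Omega\setminus(\{0\}\cup(\Omega^*+\Omega^* ))$; it is the unique minimal set generating $\Omega$ as an additive monoid (by finite sums). A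 set of real numbers is commensurable if for any pair $\lambda,\mu$ of nonzero elements of the set the fraction $\lambda/\mu$ is rational. *)

theory Defs
  imports Complex_Main
begin

definition omega_monoid :: "real set \<Rightarrow> bool" where
  "omega_monoid \<Omega> \<longleftrightarrow>
     (\<exists>a :: nat \<Rightarrow> real. strict_mono a \<and> \<Omega> = range a \<and> a 0 = 0 \<and>
        (\<forall>i\<ge>1. \<forall>j\<ge>1. a i + a j \<in> \<Omega>))"

definition tempered_monoid :: "real set \<Rightarrow> bool" where
  "tempered_monoid T \<longleftrightarrow>
     (\<exists>\<tau> :: nat \<Rightarrow> real. strict_mono \<tau> \<and> (\<forall>i. 0 \<le> \<tau> i) \<and> T = range \<tau> \<and> \<tau> 0 = 0 \<and>
        (\<forall>i\<ge>1. \<forall>j\<ge>1. \<tau> i + \<tau> j \<in> T) \<and>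
        (\<lambda>n. \<tau> (Suc n) - \<tau> n) \<longlonglongrightarrow> 0)"

definition nonzero_elements :: "real set \<Rightarrow> real set" where
  "nonzero_elements \<Omega> = \<Omega> - {0}"

definition minimal_generators :: "real set \<Rightarrow> real set" where
  "minimal_generators \<Omega> =
     \<Omega> - ({0} \<union> {x + y | x y. x \<in> nonzero_elements \<Omega> \<and> y \<in> nonzero_elements \<Omega>})"

definition commensurable :: "real set \<Rightarrow> bool" where
  "commensurable S \<longleftrightarrow>
     (\<forall>l\<in>S. \<forall>m\<in>S. l \<noteq> 0 \<longrightarrow> m \<noteq> 0 \<longrightarrow> l / m \<in> \<rat>)"

end

theory Submission
  imports Defs
begin

text \<open>
  The gaps of \<open>\<Omega>\<close> tend to \<open>0\<close> as soon as \<open>\<Omega>\<close> contains pairs \<open>v < u\<close> with \<open>\<delta> = u - v\<close>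
  arbitrarily small: the elements \<open>(n - j) v + j u = n v + j \<delta>\<close> with \<open>j \<le> n\<close> cover a whole period
  of length \<open>c \<in> \<Omega>\<close> with mesh \<open>\<delta>\<close> once \<open>n \<delta> \<ge> c\<close>, and this pattern can be shifted by multiples
  of \<open>c\<close>. By the pigeonhole principle such pairs exist whenever \<open>\<Omega>\<close> meets infinitely many classes
  modulo some \<open>c \<in> \<Omega>\<close>. Distinct minimal generators are incongruent modulo the least positive
  element, which settles the infinite case; if \<open>l / m\<close> is irrational, the multiples of \<open>l\<close> are
  incongruent modulo \<open>m\<close>. Conversely, finitely many commensurable generators lie in a lattice
  \<open>h \<int>\<close>, so the gaps are at least \<open>h\<close>.
\<close>

lemma of_nat_mult_closed:
  fixes \<Omega> :: "real set"
  assumes "0 \<in> \<Omega>" and "\<And>x y. x \<in> \<Omega> \<Longrightarrow> y \<in> \<Omega> \<Longrightarrow> x + y \<in> \<Omega>" and "x \<in> \<Omega>"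
  shows "of_nat n * x \<in> \<Omega>"
  by (induction n) (auto simp: assms distrib_right)

lemma gaps_tendsto_zero:
  fixes a :: "nat \<Rightarrow> real"
  assumes mono: "strict_mono a" and a0: "a 0 = 0"
    and add: "\<And>x y. x \<in> range a \<Longrightarrow> y \<in> range a \<Longrightarrow> x + y \<in> range a"
    and close: "\<And>\<epsilon>. \<epsilon> > 0 \<Longrightarrow> \<exists>u\<in>range a. \<exists>v\<in>range a. v < u \<and> u < v + \<epsilon>"
  shows "(\<lambda>n. a (Suc n) - a n) \<longlonglongrightarrow> 0"
proof (rule LIMSEQ_I)
  fix \<epsilon> :: real assume "\<epsilon> > 0"
  obtain u v where uv: "u \<in> range a" "v \<in> range a" "v < u" "u < v + \<epsilon>"
    using close[OF \<open>\<epsilon> > 0\<close>] by blast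
  define \<delta> where "\<delta> = u - v"
  have \<delta>: "\<delta> > 0" "\<delta> < \<epsilon>" using uv by (auto simp: \<delta>_def)
  define c where "c = a 1"
  have c: "c > 0" "c \<in> range a"
    using strict_monoD[OF mono, of 0 1] a0 by (auto simp: c_def)
  have mult: "of_nat n * x \<in> range a" if "x \<in> range a" for n x
    using of_nat_mult_closed[of "range a"] add that a0 by (metis rangeI)
  obtain n where n: "c / \<delta> \<le> of_nat n" using real_arch_simple by blast
  have next_element: "\<exists>y\<in>range a. x < y \<and> y \<le> x + \<delta>" if x: "x \<ge> of_nat n * v" for x
  proof -
    \<comment> \<open>Division with remainder gives \<open>x = n * v + k * c + r\<close> with
      \<open>0 \<le> r < c\<close>. Then \<open>j\<close> is the least number with
      \<open>j * \<delta> > r\<close>. Since \<open>r < c \<le> n * \<delta>\<close>, it is at most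
      \<open>n\<close>, so replacing \<open>j\<close> of the \<open>n\<close> copies of
      \<open>v\<close> by \<open>u\<close> is possible.\<close>
    define k where "k = nat \<lfloor>(x - of_nat n * v) / c\<rfloor>"
    define r where "r = x - of_nat n * v - of_nat k * c"
    have k: "of_nat k \<le> (x - of_nat n * v) / c" "(x - of_nat n * v) / c < of_nat k + 1"
      using x c unfolding k_def by (auto simp: of_nat_nat)
    have r: "0 \<le> r" "r < c"
      using k c by (auto simp: r_def field_simps)
    define j where "j = nat \<lfloor>r / \<delta>\<rfloor> + 1"
    have j: "of_nat j \<le> r / \<delta> + 1" "r / \<delta> < of_nat j"
      using r \<delta> floor_correct[of "r / \<delta>"] unfolding j_def by (simp_all add: of_nat_nat add.commute)
    have "r / \<delta> < of_nat n"
      using r \<delta> n by (meson divide_strict_right_mono less_le_trans)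
    with j have "j \<le> n" by linarith
    define y where "y = of_nat (n - j) * v + of_nat j * u + of_nat k * c"
    have "y = x - r + of_nat j * \<delta>"
      using \<open>j \<le> n\<close> by (simp add: y_def r_def \<delta>_def of_nat_diff algebra_simps)
    moreover have "r < of_nat j * \<delta>" "of_nat j * \<delta> \<le> r + \<delta>"
      using j \<delta> by (auto simp: field_simps)
    moreover have "y \<in> range a"
      unfolding y_def by (intro add mult uv c)
    ultimately show ?thesis by (intro bexI[of _ y]) auto
  qed
  obtain N where N: "of_nat n * v = a N" using mult[OF uv(2)] by blast
  have "norm (a (Suc m) - a m - 0) < \<epsilon>" if "m \<ge> N" for m
  proof -
    have "a m \<ge> of_nat n * v" using N mono that by (simp add: strict_mono_less_eq)
    from next_element[OF this] obtain i where i: "a m < a i" "a i \<le> a m + \<delta>" by blast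
    \<comment> \<open>As \<open>a\<close> enumerates increasingly, \<open>a (Suc m)\<close> is at
      most any element above \<open>a m\<close>, so the gap is at most
      \<open>\<delta>\<close>.\<close>
    then have "Suc m \<le> i" using mono by (simp add: strict_mono_less Suc_le_eq)
    then have "a (Suc m) \<le> a i" "a m < a (Suc m)" using mono by (simp_all add: strict_mono_less_eq strict_mono_less)
    with i \<delta> show ?thesis by simp
  qed
  then show "\<exists>N. \<forall>m\<ge>N. norm (a (Suc m) - a m - 0) < \<epsilon>" by blast
qed

text \<open>Incongruence makes the fractional parts of \<open>x / c\<close> distinct on
  \<open>S\<close>. Two of them share one of \<open>K\<close> cells of width \<open>1 / K\<close>,
  where \<open>c / K < \<epsilon>\<close>; adding multiples of \<open>c\<close> then turns this into
  a close pair inside \<open>\<Omega>\<close>.\<close>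

lemma close_pair_if_infinitely_many_residues:
  fixes \<Omega> S :: "real set"
  assumes zero: "0 \<in> \<Omega>" and add: "\<And>x y. x \<in> \<Omega> \<Longrightarrow> y \<in> \<Omega> \<Longrightarrow> x + y \<in> \<Omega>"
    and nonneg: "\<And>x. x \<in> \<Omega> \<Longrightarrow> 0 \<le> x"
    and c: "c \<in> \<Omega>" "c > 0"
    and S: "S \<subseteq> \<Omega>" "infinite S"
    and incong: "\<And>x y. x \<in> S \<Longrightarrow> y \<in> S \<Longrightarrow> x \<noteq> y \<Longrightarrow> (x - y) / c \<notin> \<int>"
    and "\<epsilon> > 0"
  shows "\<exists>u\<in>\<Omega>. \<exists>v\<in>\<Omega>. v < u \<and> u < v + \<epsilon>"
proof -
  obtain K :: nat where K: "c / \<epsilon> < of_nat K" using reals_Archimedean2 by blast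
  have "of_nat K > (0::real)" using K c \<open>\<epsilon> > 0\<close> by (meson divide_pos_pos less_trans)
  define cell where "cell x = \<lfloor>frac (x / c) * of_nat K\<rfloor>" for x
  have "cell ` S \<subseteq> {0..<int K}"
  proof
    fix z assume "z \<in> cell ` S"
    then obtain x where z: "z = cell x" by blast
    have "frac (x / c) * of_nat K < 1 * of_nat K"
      by (intro mult_strict_right_mono frac_lt_1 \<open>of_nat K > 0\<close>)
    then show "z \<in> {0..<int K}" by (simp add: z cell_def floor_less_iff)
  qed
  then have "\<not> inj_on cell S"
    using S(2) by (meson finite_atLeastLessThan_int finite_imageD finite_subset)
  then obtain x0 y0 where xy0: "x0 \<in> S" "y0 \<in> S" "x0 \<noteq> y0" "cell x0 = cell y0"
    by (auto simp: inj_on_def)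
  have frac_diff: "(x - y) / c = of_int (\<lfloor>x / c\<rfloor> - \<lfloor>y / c\<rfloor>) + (frac (x / c) - frac (y / c))" for x y
    by (simp add: frac_def diff_divide_distrib)
  have "frac (x0 / c) \<noteq> frac (y0 / c)"
    using incong[OF xy0(1-3)] frac_diff[of x0 y0] by (metis Ints_of_int add.right_neutral diff_self)
  then obtain x y where xy: "x \<in> S" "y \<in> S" "cell x = cell y" "frac (y / c) < frac (x / c)"
    using xy0 by (metis linorder_neqE_linordered_idom)
  \<comment> \<open>Multiples of \<open>c\<close> can only be added in \<open>\<Omega>\<close>, not
    subtracted. Adding them crosswise gives both \<open>u / c\<close> and \<open>v / c\<close> the
    integer part \<open>\<lfloor>x / c\<rfloor> + \<lfloor>y / c\<rfloor>\<close>, so only the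
    fractional parts differ.\<close>
  define u where "u = x + of_nat (nat \<lfloor>y / c\<rfloor>) * c"
  define v where "v = y + of_nat (nat \<lfloor>x / c\<rfloor>) * c"
  have \<Omega>: "x \<in> \<Omega>" "y \<in> \<Omega>" using xy S by auto
  then have uv: "u \<in> \<Omega>" "v \<in> \<Omega>"
    unfolding u_def v_def by (auto intro!: add of_nat_mult_closed zero c)
  have "u - v = c * (frac (x / c) - frac (y / c))"
    using \<Omega> c nonneg[of x] nonneg[of y] by (simp add: u_def v_def frac_def of_nat_nat field_simps)
  moreover have "frac (x / c) * of_nat K < frac (y / c) * of_nat K + 1"
    using xy(3) unfolding cell_def by linarith
  then have "(frac (x / c) - frac (y / c)) * of_nat K < 1" by (simp add: algebra_simps)
  then have "frac (x / c) - frac (y / c) < 1 / of_nat K"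
    using \<open>of_nat K > 0\<close> by (simp add: field_simps)
  then have "c * (frac (x / c) - frac (y / c)) < c * (1 / of_nat K)"
    using c by (intro mult_strict_left_mono)
  moreover have "c * (1 / of_nat K) < \<epsilon>"
    using K \<open>\<epsilon> > 0\<close> \<open>of_nat K > 0\<close> by (simp add: field_simps)
  moreover have "c * (frac (x / c) - frac (y / c)) > 0" using c xy by simp
  ultimately show ?thesis using uv by (intro bexI[of _ u] bexI[of _ v]) auto
qed

text \<open>The product of the denominators works. This places finitely many commensurable
  generators in one lattice.\<close>

lemma common_denominator:
  fixes S :: "'a :: field_char_0 set"
  assumes "finite S" "S \<subseteq> \<rat>"
  shows "\<exists>N::nat. N > 0 \<and> (\<forall>x\<in>S. of_nat N * x \<in> \<int>)"
  using assms
proof (induction S rule: finite_induct)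
  case empty
  show ?case by auto
next
  case (insert x S)
  then obtain N :: nat where N: "N > 0" "\<forall>x\<in>S. of_nat N * x \<in> \<int>" by auto
  from insert.prems have "x \<in> \<rat>" by simp
  then obtain p q :: int where pq: "x = of_int p / of_int q" "q > 0"
    by (metis Rats_cases')
  have "of_nat (N * nat q) * y \<in> \<int>" if "y \<in> insert x S" for y
  proof (cases "y = x")
    case True
    then have "of_nat (N * nat q) * y = of_nat N * of_int p"
      using pq by (simp add: of_nat_nat)
    also have "\<dots> \<in> \<int>" by (intro Ints_mult) auto
    finally show ?thesis .
  next
    case False
    with that N have "of_nat (nat q) * (of_nat N * y) \<in> \<int>" by auto
    then show ?thesis by (simp add: mult_ac)
  qed
  with N pq show ?case by (intro exI[of _ "N * nat q"]) auto
qed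

text \<open>A nonzero element that is not a generator splits into two positive elements, both
  smaller and hence of smaller index, so strong induction on the index applies.\<close>

lemma generators_induct:
  fixes a :: "nat \<Rightarrow> real"
  assumes mono: "strict_mono a" and a0: "a 0 = 0" and "x \<in> range a"
    and zero: "P 0"
    and gen: "\<And>x. x \<in> minimal_generators (range a) \<Longrightarrow> P x"
    and plus: "\<And>x y. P x \<Longrightarrow> P y \<Longrightarrow> P (x + y)"
  shows "P x"
proof -
  have "P (a i)" for i
  proof (induction i rule: less_induct)
    case (less i)
    show ?case
    proof (cases "a i = 0 \<or> a i \<in> minimal_generators (range a)")
      case True
      then show ?thesis using zero gen by auto
    next
      case False
      then obtain j k where jk: "a i = a j + a k" "a j \<noteq> 0" "a k \<noteq> 0"
        by (auto simp: minimal_generators_def nonzero_elements_def)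
      then have "0 < a j" "0 < a k"
        using mono a0 by (metis gr0I strict_monoD)+
      then have "a j < a i" "a k < a i" using jk by auto
      then have "j < i" "k < i" using mono by (auto simp: strict_mono_less)
      then show ?thesis using less.IH jk(1) plus by simp
    qed
  qed
  then show ?thesis using \<open>x \<in> range a\<close> by blast
qed

lemma not_tempered_if_commensurable:
  fixes a :: "nat \<Rightarrow> real"
  assumes mono: "strict_mono a" and a0: "a 0 = 0"
    and fin: "finite (minimal_generators (range a))"
    and comm: "commensurable (minimal_generators (range a))"
  shows "\<not> tempered_monoid (range a)"
proof
  let ?G = "minimal_generators (range a)"
  assume "tempered_monoid (range a)"
  \<comment> \<open>Only the range of \<open>\<tau>\<close> is compared with that of
    \<open>a\<close>: the lattice property concerns elements, not their enumeration.\<close>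
  then obtain \<tau> where \<tau>: "strict_mono \<tau>" "range a = range \<tau>" "(\<lambda>n. \<tau> (Suc n) - \<tau> n) \<longlonglongrightarrow> 0"
    unfolding tempered_monoid_def by blast
  have pos: "x > 0" if "x \<in> range a" "x \<noteq> 0" for x
    using that mono a0 by (metis gr0I imageE strict_monoD)
  have "?G \<noteq> {}"
  proof
    assume "?G = {}"
    then have "a 1 = 0"
      using generators_induct[OF mono a0, of "a 1" "\<lambda>x. x = 0"] by simp
    then show False using strict_monoD[OF mono, of 0 1] a0 by simp
  qed
  then obtain g where g: "g \<in> ?G" by blast
  then have "g > 0" using pos by (auto simp: minimal_generators_def)
  have "x / g \<in> \<rat>" if "x \<in> ?G" for x
    using comm g that \<open>g > 0\<close> unfolding commensurable_def by (cases "x = 0") auto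
  then have "(\<lambda>x. x / g) ` ?G \<subseteq> \<rat>" by blast
  with fin obtain N :: nat where N: "N > 0" "\<forall>x\<in>?G. of_nat N * (x / g) \<in> \<int>"
    using common_denominator[of "(\<lambda>x. x / g) ` ?G"] by auto
  \<comment> \<open>The lattice of integer multiples of \<open>g / N\<close> is closed under
    addition, so it contains everything its generators generate. Distinct elements thus differ by at
    least \<open>g / N\<close>.\<close>
  have lattice: "of_nat N * (x / g) \<in> \<int>" if "x \<in> range a" for x
    using generators_induct[OF mono a0 that, of "\<lambda>x. of_nat N * (x / g) \<in> \<int>"] N(2)
    by (simp add: add_divide_distrib distrib_left del: times_divide_eq_right)
  have gap: "\<tau> (Suc n) - \<tau> n \<ge> g / of_nat N" for n
  proof -
    have "of_nat N * (\<tau> (Suc n) / g) \<in> \<int>" "of_nat N * (\<tau> n / g) \<in> \<int>"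
      using lattice \<tau>(2) by auto
    then have "of_nat N * (\<tau> (Suc n) / g) - of_nat N * (\<tau> n / g) \<in> \<int>" by (rule Ints_diff)
    then obtain k :: int where k: "of_nat N * (\<tau> (Suc n) / g) - of_nat N * (\<tau> n / g) = of_int k"
      by (auto elim: Ints_cases)
    have "of_nat N * (\<tau> (Suc n) / g) - of_nat N * (\<tau> n / g) > 0"
      using \<open>g > 0\<close> N strict_monoD[OF \<tau>(1), of n "Suc n"] by (simp add: divide_strict_right_mono)
    then have "k \<ge> 1" using k by simp
    then have "of_nat N * (\<tau> (Suc n) / g) - of_nat N * (\<tau> n / g) \<ge> 1" using k by simp
    then show ?thesis using \<open>g > 0\<close> N by (simp add: field_simps)
  qed
  have "g / of_nat N \<le> 0"
    using \<tau>(3) gap by (intro Lim_bounded2[OF \<tau>(3), of 0]) auto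
  moreover have "g / of_nat N > 0" using \<open>g > 0\<close> N by simp
  ultimately show False by linarith
qed

text \<open>If \<open>x = y + k * c\<close> with \<open>k > 0\<close>, then \<open>x\<close> is a
  sum of two nonzero elements of \<open>\<Omega>\<close> and cannot be a generator.\<close>

lemma generators_incongruent:
  fixes \<Omega> :: "real set"
  assumes zero: "0 \<in> \<Omega>" and add: "\<And>x y. x \<in> \<Omega> \<Longrightarrow> y \<in> \<Omega> \<Longrightarrow> x + y \<in> \<Omega>"
    and c: "c \<in> \<Omega>" "c > 0"
    and x: "x \<in> minimal_generators \<Omega>" and y: "y \<in> minimal_generators \<Omega>" and "x \<noteq> y"
  shows "(x - y) / c \<notin> \<int>"
proof -
  have aux: False
    if gens: "x \<in> minimal_generators \<Omega>" "y \<in> minimal_generators \<Omega>" and "y < x"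
      and int: "(x - y) / c \<in> \<int>" for x y
  proof -
    obtain k where k: "(x - y) / c = of_int k" using int by (auto elim: Ints_cases)
    have "(x - y) / c > 0" using \<open>y < x\<close> c by simp
    then have "k > 0" using k by simp
    have eq: "x = y + of_nat (nat k) * c"
      using k c \<open>k > 0\<close> by (simp add: of_nat_nat field_simps)
    have "of_nat (nat k) * c \<in> nonzero_elements \<Omega>"
      using of_nat_mult_closed[OF zero add c(1), of "nat k"] c \<open>k > 0\<close>
      unfolding nonzero_elements_def by simp
    moreover have "y \<in> nonzero_elements \<Omega>"
      using gens by (auto simp: minimal_generators_def nonzero_elements_def)
    ultimately show False using gens(1) eq unfolding minimal_generators_def by blast
  qed
  have "(y - x) / c \<in> \<int>" if "(x - y) / c \<in> \<int>"
    using Ints_minus[OF that] by (simp add: minus_divide_left)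
  then show ?thesis using aux[of x y] aux[of y x] x y \<open>x \<noteq> y\<close> by (metis linorder_neqE_linordered_idom)
qed

theorem theorem18:
  fixes \<Omega> :: "real set"
  assumes "omega_monoid \<Omega>"
  shows "(infinite (minimal_generators \<Omega>) \<longrightarrow> tempered_monoid \<Omega>) \<and>
         (finite (minimal_generators \<Omega>) \<longrightarrow>
            (tempered_monoid \<Omega> \<longleftrightarrow> \<not> commensurable (minimal_generators \<Omega>)))"
proof -
  let ?G = "minimal_generators \<Omega>"
  obtain a :: "nat \<Rightarrow> real" where a: "strict_mono a" "\<Omega> = range a" "a 0 = 0"
    and closed: "\<forall>i\<ge>1. \<forall>j\<ge>1. a i + a j \<in> \<Omega>"
    using assms unfolding omega_monoid_def by blast
  have nonneg: "x \<ge> 0" if "x \<in> \<Omega>" for x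
    using that a by (metis imageE le0 strict_mono_less_eq)
  have zero: "0 \<in> \<Omega>" using a by (metis rangeI)
  have add: "x + y \<in> \<Omega>" if xy: "x \<in> \<Omega>" "y \<in> \<Omega>" for x y
  proof -
    obtain i j where "x = a i" "y = a j" using xy a(2) by blast
    \<comment> \<open>The definition gives closure for positive indices; index 0 contributes
      \<open>a 0 = 0\<close>.\<close>
    then show ?thesis using closed xy a(3) by (cases i; cases j) auto
  qed
  have G: "?G \<subseteq> \<Omega>" by (auto simp: minimal_generators_def)
  \<comment> \<open>Common criterion for both cases: \<open>S\<close> will be the set of generators
    with \<open>c = a 1\<close>, then the multiples of \<open>l\<close> with
    \<open>c = m\<close>.\<close>
  have tempered: "tempered_monoid \<Omega>"
    if c: "c \<in> \<Omega>" "c > 0" and S: "S \<subseteq> \<Omega>" "infinite S"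
      and incong: "\<And>x y. x \<in> S \<Longrightarrow> y \<in> S \<Longrightarrow> x \<noteq> y \<Longrightarrow> (x - y) / c \<notin> \<int>" for c S
  proof -
    have "\<exists>u\<in>range a. \<exists>v\<in>range a. v < u \<and> u < v + \<epsilon>" if "\<epsilon> > 0" for \<epsilon>
      using close_pair_if_infinitely_many_residues[OF zero add nonneg c S incong that] a(2) by blast
    then have "(\<lambda>n. a (Suc n) - a n) \<longlonglongrightarrow> 0"
      using add a by (intro gaps_tendsto_zero) auto
    then show ?thesis
      using a closed nonneg unfolding tempered_monoid_def by blast
  qed
  have "a 1 \<in> \<Omega>" "a 1 > 0"
    using a strict_monoD[OF a(1), of 0 1] by auto
  then have infinite_case: "tempered_monoid \<Omega>" if "infinite ?G"
    using tempered[of "a 1" ?G] G that generators_incongruent[OF zero add] by blast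
  have "tempered_monoid \<Omega>" if ncomm: "\<not> commensurable ?G"
  proof -
    obtain l m where lm: "l \<in> \<Omega>" "m \<in> \<Omega>" "l \<noteq> 0" "m \<noteq> 0" "l / m \<notin> \<rat>"
      using ncomm G unfolding commensurable_def by blast
    show ?thesis
    proof (rule tempered[of m "range (\<lambda>n. of_nat n * l)"])
      show "m \<in> \<Omega>" "m > 0" using lm nonneg[of m] by auto
      show "range (\<lambda>n. of_nat n * l) \<subseteq> \<Omega>"
        using of_nat_mult_closed[OF zero add lm(1)] by blast
      show "infinite (range (\<lambda>n. of_nat n * l))"
      proof -
        have "inj (\<lambda>n. of_nat n * l)" using lm by (auto simp: inj_def)
        then show ?thesis using finite_imageD infinite_UNIV_nat by blast
      qed
    next
      fix x y assume "x \<in> range (\<lambda>n. of_nat n * l)" "y \<in> range (\<lambda>n. of_nat n * l)" "x \<noteq> y"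
      then obtain i j where ij: "x = of_nat i * l" "y = of_nat j * l" "i \<noteq> j" by blast
      \<comment> \<open>If \<open>d * l / m\<close> were an integer, dividing by the nonzero integer
        \<open>d\<close> would make \<open>l / m\<close> rational.\<close>
      define d :: real where "d = of_nat i - of_nat j"
      have d: "d \<noteq> 0" "d \<in> \<rat>" using ij by (auto simp: d_def)
      have "x - y = d * l" by (simp add: ij d_def left_diff_distrib)
      then have eq: "l / m = ((x - y) / m) / d"
        using d by simp
      show "(x - y) / m \<notin> \<int>"
      proof
        assume "(x - y) / m \<in> \<int>"
        then have "(x - y) / m \<in> \<rat>" using Ints_subset_Rats by blast
        then have "l / m \<in> \<rat>" unfolding eq using d(2) by (rule Rats_divide)
        then show False using lm by simp
      qed
    qed
  qed
  then show ?thesis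
    using infinite_case not_tempered_if_commensurable[OF a(1,3)] a(2) by blast
qed

end
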